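(* Let $s\in(0,1)$, let $\Omega\subset\mathbb{R}^N$ be a bounded strictly convex domain of class $C^2$, and let $f\in C(\overline\Omega)$ and $g\in C(\overline{\mathbb{R}^N\setminus\Omega})$ be bounded. Let $u,v\colon\mathbb{R}^N\to\mathbb{R}$ be, respectively, a viscosity subsolution and a viscosity supersolution (in the sense described in the context) of \[ \begin{cases} \displaystyle \Lambda_1^s u(x)\coloneqq \inf\left\{\int_{\mathbb{R}}\frac{u(x+tz)-u(x)}{|t|^{1+2s}}\,dt\colon z\in\mathbb{S}^{N-1}\right\}=f(x), & x\in\Omega,\\[6pt] u(x)=g(x), & x\in\mathbb{R}^N\setminus\Omega. \end{cases} \] Then (i) $u\le g$ on $\partial\Omega$; and (ii) $v\ge g$ on $\partial\Omega$.
   Context: Integrals are principal value integrals; $\mathbb{S}^{N-1}$ is the unit sphere. For $u\colon\overline\Omega\to\mathbb{R}$ let the upper $g$-extension be $u^g=u$ in $\Omega$, $u^g=g$ in $\mathbb{R}^N\setminus\overline\Omega$, $u^g=\max\{u,g\}$ on $\partial\Omega$; the lower $g$-extension $u_g$ uses $\min$ instead. For $\delta>0$, $z\in\mathbb{S}^{N-1}$, a $C^2$ function $\phi$ and a function $w$, set $E_{z,\delta}(w,\phi,x)\coloneqq\int_{-\delta}^{\delta}\frac{\phi(x+tz)-\phi(x)}{|t|^{1+2s}}dt+\int_{\mathbb{R}\setminus(-\delta,\delta)}\frac{w(x+tz)-u(x)}{|t|^{1+2s}}dt-f(x)$ and $E_\delta(w,\phi,x)\coloneqq-\inf_{z\in\mathbb{S}^{N-1}}E_{z,\delta}(w,\phi,x)$.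 A bounded upper semicontinuous $u\colon\mathbb{R}^N\to\mathbb{R}$ is a viscosity subsolution if $u\le g$ in $\mathbb{R}^N\setminus\overline\Omega$ and for every $\delta>0$ and $\phi\in C^2(\mathbb{R}^N)$ such that $x_0$ is a maximum point of $u-\phi$ in $B_\delta(x_0)$: $E_\delta(u^g,\phi,x_0)\le0$ if $x_0\in\Omega$, and $\min\{E_\delta(u^g,\phi,x_0),u(x_0)-g(x_0)\}\le 0$ if $x_0\in\partial\Omega$ (if $u$ is not upper semicontinuous, this is required of its upper semicontinuous envelope). Viscosity supersolutions are defined analogously, with lower semicontinuity, $u_g$, minimum points and reversed inequalities (with $\max$ instead of $\min$ on $\partial\Omega$). *)

theory Defs
  imports "HOL-Analysis.Analysis"
begin

definition C2_on :: "'a::euclidean_space set \<Rightarrow> ('a \<Rightarrow> real) \<Rightarrow> bool" where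
  "C2_on U \<phi> \<longleftrightarrow> (\<exists>(G::'a \<Rightarrow> 'a) (H::'a \<Rightarrow> ('a \<Rightarrow>\<^sub>L 'a)).
      (\<forall>x\<in>U. (\<phi> has_derivative (\<lambda>h. G x \<bullet> h)) (at x)
            \<and> (G has_derivative blinfun_apply (H x)) (at x))
      \<and> continuous_on U H)"

definition C2_boundary :: "'a::euclidean_space set \<Rightarrow> bool" where
  "C2_boundary \<Omega> \<longleftrightarrow> (\<forall>p\<in>frontier \<Omega>. \<exists>U \<rho> G.
      open U \<and> p \<in> U \<and> C2_on U \<rho> \<and>
      (\<forall>x\<in>U. (\<rho> has_derivative (\<lambda>h. G x \<bullet> h)) (at x)) \<and>
      \<Omega> \<inter> U = {x\<in>U. \<rho> x < 0} \<and>
      (\<forall>x\<in>U \<inter> frontier \<Omega>. G x \<noteq> 0))"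

definition strictly_convex_set :: "'a::euclidean_space set \<Rightarrow> bool" where
  "strictly_convex_set \<Omega> \<longleftrightarrow>
     (\<forall>x\<in>closure \<Omega>. \<forall>y\<in>closure \<Omega>. x \<noteq> y \<longrightarrow> open_segment x y \<subseteq> \<Omega>)"

definition bdd_strictly_convex_C2_domain :: "'a::euclidean_space set \<Rightarrow> bool" where
  "bdd_strictly_convex_C2_domain \<Omega> \<longleftrightarrow>
     open \<Omega> \<and> connected \<Omega> \<and> \<Omega> \<noteq> {} \<and> bounded \<Omega> \<and>
     strictly_convex_set \<Omega> \<and> C2_boundary \<Omega>"

definition usc :: "('a::metric_space \<Rightarrow> real) \<Rightarrow> bool" where
  "usc u \<longleftrightarrow> (\<forall>x e. e > 0 \<longrightarrow> (\<exists>d>0. \<forall>y. dist y x < d \<longrightarrow> u y < u x + e))"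

definition lsc :: "('a::metric_space \<Rightarrow> real) \<Rightarrow> bool" where
  "lsc u \<longleftrightarrow> (\<forall>x e. e > 0 \<longrightarrow> (\<exists>d>0. \<forall>y. dist y x < d \<longrightarrow> u y > u x - e))"

definition usc_env :: "('a::metric_space \<Rightarrow> real) \<Rightarrow> 'a \<Rightarrow> real" where
  "usc_env u x = (INF r\<in>{0<..}. SUP y\<in>ball x r. u y)"

definition lsc_env :: "('a::metric_space \<Rightarrow> real) \<Rightarrow> 'a \<Rightarrow> real" where
  "lsc_env u x = (SUP r\<in>{0<..}. INF y\<in>ball x r. u y)"

definition upper_ext :: "'a::euclidean_space set \<Rightarrow> ('a \<Rightarrow> real) \<Rightarrow> ('a \<Rightarrow> real) \<Rightarrow> 'a \<Rightarrow> real" where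
  "upper_ext \<Omega> g u x = (if x \<in> \<Omega> then u x else if x \<in> frontier \<Omega> then max (u x) (g x) else g x)"

definition lower_ext :: "'a::euclidean_space set \<Rightarrow> ('a \<Rightarrow> real) \<Rightarrow> ('a \<Rightarrow> real) \<Rightarrow> 'a \<Rightarrow> real" where
  "lower_ext \<Omega> g u x = (if x \<in> \<Omega> then u x else if x \<in> frontier \<Omega> then min (u x) (g x) else g x)"

text \<open>E_{z,\<delta>}(w,\<phi>,x) for the tested function u; the inner integral is a principal value.\<close>
definition Ezd :: "real \<Rightarrow> ('a::euclidean_space \<Rightarrow> real) \<Rightarrow> 'a \<Rightarrow> real \<Rightarrow> ('a \<Rightarrow> real)
                   \<Rightarrow> ('a \<Rightarrow> real) \<Rightarrow> ('a \<Rightarrow> real) \<Rightarrow> 'a \<Rightarrow> real" where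
  "Ezd s f z \<delta> u w \<phi> x =
     Lim (at_right 0) (\<lambda>\<epsilon>. integral {t. \<epsilon> < \<bar>t\<bar> \<and> \<bar>t\<bar> < \<delta>}
                            (\<lambda>t. (\<phi> (x + t *\<^sub>R z) - \<phi> x) / \<bar>t\<bar> powr (1 + 2 * s)))
     + integral {t. \<delta> \<le> \<bar>t\<bar>} (\<lambda>t. (w (x + t *\<^sub>R z) - u x) / \<bar>t\<bar> powr (1 + 2 * s))
     - f x"

definition Ed :: "real \<Rightarrow> ('a::euclidean_space \<Rightarrow> real) \<Rightarrow> real \<Rightarrow> ('a \<Rightarrow> real)
                   \<Rightarrow> ('a \<Rightarrow> real) \<Rightarrow> ('a \<Rightarrow> real) \<Rightarrow> 'a \<Rightarrow> real" where
  "Ed s f \<delta> u w \<phi> x = - (INF z\<in>sphere 0 1. Ezd s f z \<delta> u w \<phi> x)"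

definition visc_sub_core :: "real \<Rightarrow> 'a::euclidean_space set \<Rightarrow> ('a \<Rightarrow> real) \<Rightarrow> ('a \<Rightarrow> real)
                              \<Rightarrow> ('a \<Rightarrow> real) \<Rightarrow> bool" where
  "visc_sub_core s \<Omega> f g u \<longleftrightarrow>
     (\<forall>x. x \<notin> closure \<Omega> \<longrightarrow> u x \<le> g x) \<and>
     (\<forall>\<delta> \<phi> x0. \<delta> > 0 \<longrightarrow> C2_on UNIV \<phi> \<longrightarrow>
        (\<forall>y\<in>ball x0 \<delta>. u y - \<phi> y \<le> u x0 - \<phi> x0) \<longrightarrow>
        (x0 \<in> \<Omega> \<longrightarrow> Ed s f \<delta> u (upper_ext \<Omega> g u) \<phi> x0 \<le> 0) \<and>
        (x0 \<in> frontier \<Omega> \<longrightarrow> min (Ed s f \<delta> u (upper_ext \<Omega> g u) \<phi> x0) (u x0 - g x0) \<le> 0))"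

definition visc_super_core :: "real \<Rightarrow> 'a::euclidean_space set \<Rightarrow> ('a \<Rightarrow> real) \<Rightarrow> ('a \<Rightarrow> real)
                              \<Rightarrow> ('a \<Rightarrow> real) \<Rightarrow> bool" where
  "visc_super_core s \<Omega> f g u \<longleftrightarrow>
     (\<forall>x. x \<notin> closure \<Omega> \<longrightarrow> u x \<ge> g x) \<and>
     (\<forall>\<delta> \<phi> x0. \<delta> > 0 \<longrightarrow> C2_on UNIV \<phi> \<longrightarrow>
        (\<forall>y\<in>ball x0 \<delta>. u y - \<phi> y \<ge> u x0 - \<phi> x0) \<longrightarrow>
        (x0 \<in> \<Omega> \<longrightarrow> Ed s f \<delta> u (lower_ext \<Omega> g u) \<phi> x0 \<ge> 0) \<and>
        (x0 \<in> frontier \<Omega> \<longrightarrow> max (Ed s f \<delta> u (lower_ext \<Omega> g u) \<phi> x0) (u x0 - g x0) \<ge> 0))"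

definition viscosity_subsolution :: "real \<Rightarrow> 'a::euclidean_space set \<Rightarrow> ('a \<Rightarrow> real) \<Rightarrow> ('a \<Rightarrow> real)
                              \<Rightarrow> ('a \<Rightarrow> real) \<Rightarrow> bool" where
  "viscosity_subsolution s \<Omega> f g u \<longleftrightarrow> bounded (range u) \<and>
     visc_sub_core s \<Omega> f g (if usc u then u else usc_env u)"

definition viscosity_supersolution :: "real \<Rightarrow> 'a::euclidean_space set \<Rightarrow> ('a \<Rightarrow> real) \<Rightarrow> ('a \<Rightarrow> real)
                              \<Rightarrow> ('a \<Rightarrow> real) \<Rightarrow> bool" where
  "viscosity_supersolution s \<Omega> f g u \<longleftrightarrow> bounded (range u) \<and>
     visc_super_core s \<Omega> f g (if lsc u then u else lsc_env u)"

end

theory Submission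
  imports Defs
begin

text \<open>
  Suppose a supersolution satisfies v(x0) < g(x0) at a boundary point with outer normal n, and let
  c be the gap. Minimise v(y) - k n.(y - x0) over the closure of \<open>\<Omega>\<close>: by strict convexity the
  minimiser x tends to x0 as k grows. Outside \<open>\<Omega>\<close> the function jumps up by about c, so the linear
  function with slope kn touches v from below at x in a ball of radius of order c/k, and being
  linear it contributes nothing to the principal value. On any line x + tz the increments at t and
  -t add up to something nonnegative: if both points lie in the closure of \<open>\<Omega>\<close>, the linear lower
  bounds cancel, and otherwise the gain c at an exterior point beats the loss c/8 allowed by lower
  semicontinuity. Moreover, one of the two points is exterior as soon as |t| exceeds a length L
  that is small uniformly in z. The nonlocal term is therefore at least of order L to the power
  -2s in all directions, which contradicts the inequality at x. Subsolutions reduce to the same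
  construction applied to -u.
\<close>

section \<open>Semicontinuity, envelopes and measurability\<close>

lemma lsc_uminus_iff: "lsc (\<lambda>x. - u x) \<longleftrightarrow> usc u"
  by (simp add: lsc_def usc_def algebra_simps)

lemma lsc_env_conv_usc_env: "lsc_env u x = - usc_env (\<lambda>x. - u x) x"
  by (simp add: lsc_env_def usc_env_def Inf_real_def image_image)

text \<open>Boundedness of \<open>u\<close> makes every \<open>SUP\<close> and \<open>INF\<close> in
  the envelope a genuine supremum or infimum in the conditionally complete reals.\<close>

lemma
  fixes u :: "'a::metric_space \<Rightarrow> real"
  assumes "bounded (range u)"
  shows usc_usc_env: "usc (usc_env u)"
    and usc_env_ge: "u x \<le> usc_env u x"
    and bounded_usc_env: "bounded (range (usc_env u))"
proof -
  obtain M where M: "\<And>x. \<bar>u x\<bar> \<le> M"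
    using assms unfolding bounded_iff by auto
  define S where "S x r = (SUP y\<in>ball x r. u y)" for x r
  have bdd: "bdd_above (u ` A)" for A
    using M by (intro bdd_aboveI[of _ M]) (auto simp: abs_le_iff)
  have S_ge: "u y \<le> S x r" if "y \<in> ball x r" for x y r
    unfolding S_def using that by (intro cSUP_upper bdd)
  have S_le: "S x r \<le> M" if "r > 0" for x r
    unfolding S_def using that M by (intro cSUP_least) (auto simp: abs_le_iff)
  have bdd_S: "bdd_below (S x ` {0<..})" for x
    using S_ge[of x x] by (intro bdd_belowI[of _ "u x"]) auto
  have env: "usc_env u x = (INF r\<in>{0<..}. S x r)" for x
    by (simp add: usc_env_def S_def)
  have env_le: "usc_env u x \<le> S x r" if "r > 0" for x r
    unfolding env using that by (intro cINF_lower bdd_S) auto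
  have ge: "u x \<le> usc_env u x" for x
    unfolding env using S_ge[of x x] by (intro cINF_greatest) auto
  then show "u x \<le> usc_env u x" .
  have "\<bar>usc_env u x\<bar> \<le> M" for x
    using ge[of x] env_le[of 1 x] S_le[of 1 x] M[of x] by linarith
  then show "bounded (range (usc_env u))"
    unfolding bounded_iff by auto
  show "usc (usc_env u)"
    unfolding usc_def
  proof (intro allI impI)
    fix x and e :: real
    assume "e > 0"
    then have "(INF r\<in>{0<..}. S x r) < usc_env u x + e"
      by (simp add: env)
    then obtain r where r: "r > 0" "S x r < usc_env u x + e"
      using cINF_less_iff[OF _ bdd_S] by auto
    \<comment> \<open>With half the radius, the ball about \<open>y\<close> still lies in
      \<open>ball x r\<close>, so one nearly optimal \<open>r\<close> at \<open>x\<close> controls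
      the envelope at all nearby \<open>y\<close>.\<close>
    have "usc_env u y < usc_env u x + e" if "dist y x < r / 2" for y
    proof -
      have "S y (r / 2) \<le> S x r"
        unfolding S_def
      proof (rule cSUP_subset_mono[OF _ bdd])
        show "ball y (r / 2) \<subseteq> ball x r"
          using that by metric
      qed (use r in auto)
      then show ?thesis
        using env_le[of "r / 2" y] r by simp
    qed
    then show "\<exists>d>0. \<forall>y. dist y x < d \<longrightarrow> usc_env u y < usc_env u x + e"
      using r by (intro exI[of _ "r / 2"]) auto
  qed
qed

lemma open_greater_lsc:
  assumes "lsc v"
  shows "open {x. a < v x}"
  unfolding open_dist
proof (intro ballI)
  fix x assume "x \<in> {x. a < v x}"
  then have "v x - a > 0" by simp
  then obtain d where "d > 0" "\<And>y. dist y x < d \<Longrightarrow> v y > v x - (v x - a)"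
    using assms unfolding lsc_def by blast
  then show "\<exists>e>0. \<forall>y. dist y x < e \<longrightarrow> y \<in> {x. a < v x}"
    by auto
qed

lemma borel_measurable_lsc:
  fixes v :: "'a::euclidean_space \<Rightarrow> real"
  assumes "lsc v"
  shows "v \<in> borel_measurable borel"
  unfolding borel_measurable_iff_greater
  using open_greater_lsc[OF assms] by auto

lemma lsc_add_continuous:
  assumes "lsc v" "continuous_on UNIV h"
  shows "lsc (\<lambda>x. v x + h x)"
  unfolding lsc_def
proof (intro allI impI)
  fix x and e :: real
  assume "e > 0"
  then obtain d1 where d1: "d1 > 0" "\<And>y. dist y x < d1 \<Longrightarrow> v y > v x - e / 2"
    using assms(1) unfolding lsc_def by (meson half_gt_zero)
  obtain d2 where d2: "d2 > 0" "\<And>y. dist y x < d2 \<Longrightarrow> dist (h y) (h x) < e / 2"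
    using assms(2) \<open>e > 0\<close> unfolding continuous_on_iff by (meson UNIV_I half_gt_zero)
  have "v y + h y > v x + h x - e" if "dist y x < min d1 d2" for y
    using d1(2)[of y] d2(2)[of y] that unfolding dist_real_def by linarith
  then show "\<exists>d>0. \<forall>y. dist y x < d \<longrightarrow> v y + h y > v x + h x - e"
    using d1(1) d2(1) by (intro exI[of _ "min d1 d2"]) auto
qed

text \<open>Without a minimiser the open sets \<open>{y. v x < v y}\<close>,
  \<open>x \<in> K\<close>, would cover \<open>K\<close>. In a finite subcover the centre with the
  least value lies in none of the sets.\<close>

lemma lsc_attains_inf:
  assumes "compact K" "K \<noteq> {}" "lsc v"
  obtains x where "x \<in> K" "\<And>y. y \<in> K \<Longrightarrow> v x \<le> v y"
proof (rule ccontr)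
  assume contra: "\<not> thesis"
  have "K \<subseteq> (\<Union>x\<in>K. {y. v x < v y})"
    using that contra by (force simp: not_le)
  then obtain C where C: "C \<subseteq> K" "finite C" "K \<subseteq> (\<Union>x\<in>C. {y. v x < v y})"
    using compactE_image[OF assms(1), of K "\<lambda>x. {y. v x < v y}"] open_greater_lsc[OF assms(3)]
    by metis
  then have "C \<noteq> {}" using assms(2) by auto
  then obtain x where x: "x \<in> C" "\<And>y. y \<in> C \<Longrightarrow> v x \<le> v y"
    using C(2) by (metis arg_min_if_finite(1) arg_min_least)
  then show False using C by fastforce
qed

lemma lower_ext_measurable:
  assumes "open \<Omega>" "lsc v" "continuous_on (- \<Omega>) g"
  shows "lower_ext \<Omega> g v \<in> borel_measurable borel"
proof -
  note [measurable] = borel_measurable_lsc[OF assms(2)]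
  have [measurable]: "\<Omega> \<in> sets borel" "frontier \<Omega> \<in> sets borel"
    using assms(1) by auto
  have [measurable]: "(\<lambda>x. indicator (- \<Omega>) x *\<^sub>R g x) \<in> borel_measurable borel"
    using assms by (intro borel_measurable_continuous_on_indicator) auto
  \<comment> \<open>Nothing is known about \<open>g\<close> inside \<Omega>. Cutting it off by an
    indicator gives a Borel function and changes no value that the extension reads.\<close>
  have "lower_ext \<Omega> g v = (\<lambda>x. if x \<in> \<Omega> then v x else if x \<in> frontier \<Omega>
      then min (v x) (indicator (- \<Omega>) x *\<^sub>R g x) else indicator (- \<Omega>) x *\<^sub>R g x)"
    by (auto simp: lower_ext_def fun_eq_iff)
  also have "\<dots> \<in> borel_measurable borel"
    by measurable
  finally show ?thesis .
qed

section \<open>Linear test functions and integrals against the power kernel\<close>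

lemma C2_on_inner: "C2_on U (\<lambda>y. a \<bullet> y)"
  unfolding C2_on_def
  by (rule exI[of _ "\<lambda>_. a"], rule exI[of _ "\<lambda>_. 0"])
    (auto intro!: derivative_eq_intros)

lemma has_bochner_integral_powr_tail:
  fixes a p :: real
  assumes "a > 0" "p > 1"
  shows "has_bochner_integral lborel (\<lambda>t. indicator {t. a \<le> \<bar>t\<bar>} t / \<bar>t\<bar> powr p)
           (2 * (a powr (1 - p) / (p - 1)))"
proof -
  define h where "h t = indicator {a..} t * t powr - p" for t :: real
  define I where "I = a powr (1 - p) / (p - 1)"
  have "((\<lambda>t. t powr - p) has_integral I) {a..}"
    using has_integral_powr_to_inf[of "- p" a] assms minus_divide_right[of "a powr (1 - p)" "1 - p"]
    by (simp add: I_def)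
  then have "(h has_integral I) UNIV"
    unfolding h_def has_integral_restrict_UNIV[of "{a..}", symmetric]
    by (rule has_integral_eq[rotated]) (auto simp: indicator_def)
  moreover have [measurable]: "h \<in> borel_measurable borel"
    unfolding h_def by measurable
  moreover have "h t \<ge> 0" for t
    by (simp add: h_def)
  moreover have "I \<ge> 0"
    using assms by (simp add: I_def)
  ultimately have h: "has_bochner_integral lborel h I"
    by (intro has_bochner_integral_nn_integral nn_integral_has_integral_lborel) auto
  \<comment> \<open>Reflection gives the negative half line; since \<open>a > 0\<close> the two
    halves are disjoint and their sum is the two-sided tail.\<close>
  then have "has_bochner_integral lborel (\<lambda>t. h (0 + (-1) * t)) I"
    using lborel_has_bochner_integral_real_affine_iff[of "-1" h I 0] by simp
  from has_bochner_integral_add[OF h this] show ?thesis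
    using assms unfolding I_def
    by (elim has_bochner_integral_cong[THEN iffD1, rotated -1])
      (auto simp: h_def indicator_def powr_minus divide_inverse)
qed

lemma integrable_powr_tail:
  fixes p \<delta> M :: real
  assumes "\<delta> > 0" "p > 1" and [measurable]: "F \<in> borel_measurable borel"
    and "\<And>t. \<bar>F t\<bar> \<le> M"
  shows "integrable lborel (\<lambda>t. indicator {t. \<delta> \<le> \<bar>t\<bar>} t * (F t / \<bar>t\<bar> powr p))"
proof (rule Bochner_Integration.integrable_bound)
  show "integrable lborel (\<lambda>t. M * (indicator {t. \<delta> \<le> \<bar>t\<bar>} t / \<bar>t\<bar> powr p))"
    using has_bochner_integral_powr_tail[OF assms(1,2)]
    by (intro integrable_mult_right) (rule integrable.intros)
  show "AE t in lborel. norm (indicator {t. \<delta> \<le> \<bar>t\<bar>} t * (F t / \<bar>t\<bar> powr p))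
      \<le> norm (M * (indicator {t. \<delta> \<le> \<bar>t\<bar>} t / \<bar>t\<bar> powr p))"
    using assms(4) by (intro AE_I2) (auto simp: abs_mult indicator_def intro!: divide_right_mono order_trans[OF _ abs_ge_self])
qed measurable

text \<open>The operator is defined with the gauge integral, while reflection and comparison are
  carried out for the Lebesgue integral. Absolute integrability of the tail identifies the
  two.\<close>

lemma integral_powr_tail_eq:
  fixes p \<delta> M :: real
  assumes "\<delta> > 0" "p > 1" "F \<in> borel_measurable borel" "\<And>t. \<bar>F t\<bar> \<le> M"
  shows "integral {t. \<delta> \<le> \<bar>t\<bar>} (\<lambda>t. F t / \<bar>t\<bar> powr p)
       = (LINT t|lborel. indicator {t. \<delta> \<le> \<bar>t\<bar>} t * (F t / \<bar>t\<bar> powr p))"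
  using set_borel_integral_eq_integral(2)[of "{t. \<delta> \<le> \<bar>t\<bar>}" "\<lambda>t. F t / \<bar>t\<bar> powr p"]
    integrable_powr_tail[OF assms]
  by (simp add: set_integrable_def set_lebesgue_integral_def)

text \<open>Serves to bound the directional operators uniformly in the direction, so that their
  infimum can be compared with a single member.\<close>

lemma integral_powr_tail_bound:
  fixes p \<delta> M :: real
  assumes "\<delta> > 0" "p > 1" "F \<in> borel_measurable borel" "\<And>t. \<bar>F t\<bar> \<le> M"
  shows "integral {t. \<delta> \<le> \<bar>t\<bar>} (\<lambda>t. F t / \<bar>t\<bar> powr p) \<le> M * (2 * (\<delta> powr (1 - p) / (p - 1)))"
proof -
  note J = has_bochner_integral_mult_right[OF has_bochner_integral_powr_tail[OF assms(1,2)], of M]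
  have "(LINT t|lborel. indicator {t. \<delta> \<le> \<bar>t\<bar>} t * (F t / \<bar>t\<bar> powr p))
      \<le> (LINT t|lborel. M * (indicator {t. \<delta> \<le> \<bar>t\<bar>} t / \<bar>t\<bar> powr p))"
    using assms(4) J
    by (intro integral_mono integrable_powr_tail[OF assms])
      (auto simp: indicator_def abs_le_iff has_bochner_integral_iff intro!: divide_right_mono)
  then show ?thesis
    using J by (simp add: integral_powr_tail_eq[OF assms] has_bochner_integral_iff)
qed

text \<open>By reflection, twice the integral is that of the symmetrised increment
  \<open>F t + F (- t)\<close>. This is nonnegative up to \<open>L\<close>, at least
  \<open>b\<close> from \<open>L\<close> to \<open>r\<close>, and at least \<open>- 2 * M\<close>
  beyond \<open>r\<close>.\<close>

lemma integral_powr_tail_lower: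
  fixes p \<delta> L r b M :: real
  assumes "0 < \<delta>" "\<delta> \<le> L" "L \<le> r" "p > 1" "0 \<le> b"
    and [measurable]: "F \<in> borel_measurable borel"
    and bound: "\<And>t. \<bar>F t\<bar> \<le> M"
    and near: "\<And>t. \<delta> \<le> \<bar>t\<bar> \<Longrightarrow> \<bar>t\<bar> < r \<Longrightarrow> 0 \<le> F t + F (- t)"
    and far: "\<And>t. L \<le> \<bar>t\<bar> \<Longrightarrow> \<bar>t\<bar> < r \<Longrightarrow> b \<le> F t + F (- t)"
  shows "b * (L powr (1 - p) / (p - 1)) - (b + 2 * M) * (r powr (1 - p) / (p - 1))
       \<le> integral {t. \<delta> \<le> \<bar>t\<bar>} (\<lambda>t. F t / \<bar>t\<bar> powr p)"
proof -
  define h where "h t = indicator {t. \<delta> \<le> \<bar>t\<bar>} t * (F t / \<bar>t\<bar> powr p)" for t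
  define k where "k a t = indicator {t. a \<le> \<bar>t\<bar>} t / \<bar>t\<bar> powr p" for a t :: real
  define J where "J a = a powr (1 - p) / (p - 1)" for a
  have k: "has_bochner_integral lborel (k a) (2 * J a)" if "a > 0" for a
    unfolding k_def J_def using that assms by (intro has_bochner_integral_powr_tail)
  have h: "integrable lborel h"
    unfolding h_def using assms bound by (intro integrable_powr_tail) auto
  have h': "integrable lborel (\<lambda>t. h (- t))" "(LINT t|lborel. h (- t)) = integral\<^sup>L lborel h"
    using lborel_integrable_real_affine[OF h, of "-1" 0]
      lborel_integral_real_affine[of "-1" h 0] by simp_all
  have lower: "has_bochner_integral lborel (\<lambda>t. b * k L t - (b + 2 * M) * k r t)
      (b * (2 * J L) - (b + 2 * M) * (2 * J r))"
    using assms by (intro has_bochner_integral_diff has_bochner_integral_mult_right k) auto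
  have "b * k L t - (b + 2 * M) * k r t \<le> h t + h (- t)" for t
  proof -
    have "F t + F (- t) \<ge> - 2 * M"
      using bound[of t] bound[of "- t"] by linarith
    \<comment> \<open>The left side encodes all three ranges: beyond \<open>r\<close> both
      indicators are 1 and it equals \<open>- 2 * M\<close>.\<close>
    then have "b * indicator {t. L \<le> \<bar>t\<bar>} t - (b + 2 * M) * indicator {t. r \<le> \<bar>t\<bar>} t
        \<le> indicator {t. \<delta> \<le> \<bar>t\<bar>} t * (F t + F (- t))"
      using near[of t] far[of t] assms by (auto simp: indicator_def)
    from divide_right_mono[OF this, of "\<bar>t\<bar> powr p"] show ?thesis
      by (simp add: h_def k_def indicator_def field_simps diff_divide_distrib add_divide_distrib)
  qed
  then have "(LINT t|lborel. b * k L t - (b + 2 * M) * k r t) \<le> (LINT t|lborel. h t + h (- t))"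
    using lower h h' by (intro integral_mono) (auto simp: has_bochner_integral_iff)
  then have "b * (2 * J L) - (b + 2 * M) * (2 * J r) \<le> 2 * integral\<^sup>L lborel h"
    using lower h h' by (simp add: has_bochner_integral_iff)
  then show ?thesis
    using integral_powr_tail_eq[of \<delta> p F M] assms bound
    unfolding J_def[symmetric] h_def by (simp add: algebra_simps)
qed

text \<open>An odd integrand over a symmetric set; \<open>\<epsilon> > 0\<close> keeps the
  singularity out, so the integral exists.\<close>

lemma integral_odd_powr_annulus:
  fixes m p \<epsilon> \<delta> :: real
  assumes "\<epsilon> > 0"
  shows "integral {t. \<epsilon> < \<bar>t\<bar> \<and> \<bar>t\<bar> < \<delta>} (\<lambda>t. t * m / \<bar>t\<bar> powr p) = 0"
proof -
  let ?S = "{t. \<epsilon> < \<bar>t\<bar> \<and> \<bar>t\<bar> < \<delta>}"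
  let ?f = "\<lambda>t. t * m / \<bar>t\<bar> powr p"
  define h where "h t = indicator ?S t * ?f t" for t
  have "set_integrable lborel ({-\<delta>..-\<epsilon>} \<union> {\<epsilon>..\<delta>}) ?f"
    unfolding set_integrable_def using assms
    by (intro borel_integrable_compact compact_Un compact_Icc) (auto intro!: continuous_intros)
  then have int: "set_integrable lborel ?S ?f"
    by (rule set_integrable_subset) auto
  then have "(LINT t|lborel. h t) = (LINT t|lborel. h (- t))"
    using lborel_integral_real_affine[of "-1" h 0] by simp
  also have "\<dots> = - (LINT t|lborel. h t)"
    by (subst Bochner_Integration.integral_minus[symmetric], rule arg_cong[where f = "integral\<^sup>L lborel"])
      (auto simp: h_def indicator_def)
  finally show ?thesis
    using set_borel_integral_eq_integral(2)[OF int]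
    by (simp add: set_lebesgue_integral_def h_def)
qed

text \<open>Every truncated inner integral vanishes by oddness, hence so does the principal value;
  only the tail and \<open>f x\<close> remain.\<close>

lemma Ezd_inner:
  "Ezd s f z \<delta> u w (\<lambda>y. a \<bullet> y) x
     = integral {t. \<delta> \<le> \<bar>t\<bar>} (\<lambda>t. (w (x + t *\<^sub>R z) - u x) / \<bar>t\<bar> powr (1 + 2 * s)) - f x"
proof -
  have "((\<lambda>\<epsilon>. integral {t. \<epsilon> < \<bar>t\<bar> \<and> \<bar>t\<bar> < \<delta>}
          (\<lambda>t. (a \<bullet> (x + t *\<^sub>R z) - a \<bullet> x) / \<bar>t\<bar> powr (1 + 2 * s))) \<longlongrightarrow> 0) (at_right 0)"
    using integral_odd_powr_annulus
    by (intro tendsto_eventually eventually_at_right_less[THEN eventually_mono])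
      (simp add: inner_add_right)
  then show ?thesis
    unfolding Ezd_def by (simp add: tendsto_Lim)
qed

section \<open>Supporting hyperplanes and the boundary barrier\<close>

lemma strictly_convex_supporting_normal:
  assumes "open \<Omega>" "\<Omega> \<noteq> {}" "strictly_convex_set \<Omega>" "x0 \<in> frontier \<Omega>"
  obtains n where "norm n = 1" "\<And>y. y \<in> closure \<Omega> \<Longrightarrow> y \<noteq> x0 \<Longrightarrow> n \<bullet> (y - x0) < 0"
proof -
  have x0: "x0 \<in> closure \<Omega>" "x0 \<notin> \<Omega>"
    using assms by (auto simp: frontier_def interior_open)
  have "convex \<Omega>"
    unfolding convex_contains_open_segment
    using assms(3) closure_subset unfolding strictly_convex_set_def
    by (metis empty_subsetI open_segment_idem subsetD)
  moreover have rel: "rel_interior \<Omega> = \<Omega>"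
    using assms(1) by (rule rel_interior_open)
  ultimately obtain a where a: "a \<noteq> 0" "\<And>y. y \<in> \<Omega> \<Longrightarrow> a \<bullet> x0 < a \<bullet> y"
    using x0 by (elim supporting_hyperplane_relative_frontier[of \<Omega> x0]) simp_all
  \<comment> \<open>The hyperplane is strict only on the open set. Strict convexity puts the
    midpoint of \<open>x0\<close> and \<open>y\<close> there, which carries strictness over to all
    of the closure except \<open>x0\<close>.\<close>
  have strict: "a \<bullet> (y - x0) > 0" if "y \<in> closure \<Omega>" "y \<noteq> x0" for y
  proof -
    have "midpoint x0 y \<in> open_segment x0 y"
      using that by (simp add: midpoint_in_open_segment)
    then have "midpoint x0 y \<in> \<Omega>"
      using assms(3) x0(1) that unfolding strictly_convex_set_def by (metis subsetD)
    from a(2)[OF this] show ?thesis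
      by (simp add: midpoint_def inner_simps)
  qed
  show thesis
  proof (rule that[of "- sgn a"])
    show "norm (- sgn a) = 1"
      using a(1) by (simp add: norm_sgn)
    show "- sgn a \<bullet> (y - x0) < 0" if "y \<in> closure \<Omega>" "y \<noteq> x0" for y
      using strict[OF that] a(1) by (simp add: sgn_div_norm)
  qed
qed

text \<open>Free of \<open>f\<close> and of any equation, with \<open>C\<close> arbitrary, so that
  it applies to \<open>v\<close> and to \<open>- u\<close> alike. The touching point may be interior
  or on the frontier; in the latter case \<open>v x < g x\<close> rules out the boundary
  alternative.\<close>

lemma boundary_barrier:
  fixes \<Omega> :: "'a::euclidean_space set" and v g :: "'a \<Rightarrow> real"
  assumes s: "s > 0"
    and \<Omega>: "open \<Omega>" "bounded \<Omega>" "\<Omega> \<noteq> {}" "strictly_convex_set \<Omega>"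
    and v: "lsc v" "bounded (range v)"
    and g: "continuous_on (- \<Omega>) g" "bounded (g ` (- \<Omega>))"
    and ext: "\<And>x. x \<notin> closure \<Omega> \<Longrightarrow> g x \<le> v x"
    and x0: "x0 \<in> frontier \<Omega>" "v x0 < g x0"
  obtains a \<delta> x where "\<delta> > 0" "x \<in> closure \<Omega>"
    "\<forall>y\<in>ball x \<delta>. v x - a \<bullet> x \<le> v y - a \<bullet> y"
    "x \<in> frontier \<Omega> \<longrightarrow> v x < g x"
    "\<forall>z\<in>sphere 0 1. C \<le> integral {t. \<delta> \<le> \<bar>t\<bar>}
        (\<lambda>t. (lower_ext \<Omega> g v (x + t *\<^sub>R z) - v x) / \<bar>t\<bar> powr (1 + 2 * s))"
proof -
  define c where "c = g x0 - v x0"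
  have c: "c > 0" using x0 by (simp add: c_def)
  have x0': "x0 \<in> closure \<Omega>" "x0 \<notin> \<Omega>"
    using x0 \<Omega> by (auto simp: frontier_def interior_open)
  obtain n where n: "norm n = 1" "\<And>y. y \<in> closure \<Omega> \<Longrightarrow> y \<noteq> x0 \<Longrightarrow> n \<bullet> (y - x0) < 0"
    using strictly_convex_supporting_normal[OF \<Omega>(1,3,4) x0(1)] by blast
  have frontier: "x \<in> frontier \<Omega> \<longleftrightarrow> x \<in> closure \<Omega> \<and> x \<notin> \<Omega>" for x
    using \<Omega>(1) by (auto simp: frontier_def interior_open)
  obtain M1 M2 where "\<And>x. \<bar>v x\<bar> \<le> M1" "\<And>x. x \<notin> \<Omega> \<Longrightarrow> \<bar>g x\<bar> \<le> M2"
    using v(2) g(2) unfolding bounded_iff by auto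
  then obtain M where M: "\<And>x. \<bar>v x\<bar> \<le> M" "\<And>x. x \<notin> \<Omega> \<Longrightarrow> \<bar>g x\<bar> \<le> M"
    by (metis max.coboundedI1 max.coboundedI2)
  have w_bound: "\<bar>lower_ext \<Omega> g v x\<bar> \<le> M" for x
    using M[of x] by (auto simp: lower_ext_def)
  \<comment> \<open>The factor 2 lets the ball of radius \<open>r\<close> about the later touching
    point \<open>x\<close> fit into the region controlled around \<open>x0\<close>.\<close>
  obtain r where r: "r > 0" "\<And>y. dist y x0 < 2 * r \<Longrightarrow> v x0 - c / 8 < v y"
    "\<And>y. y \<notin> \<Omega> \<Longrightarrow> dist y x0 < 2 * r \<Longrightarrow> g x0 - c / 8 < g y"
  proof -
    obtain d1 where d1: "d1 > 0" "\<And>y. dist y x0 < d1 \<Longrightarrow> v x0 - c / 8 < v y"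
      using v(1) c unfolding lsc_def by (metis divide_pos_pos zero_less_numeral)
    obtain d2 where d2: "d2 > 0" "\<And>y. y \<in> - \<Omega> \<Longrightarrow> dist y x0 < d2 \<Longrightarrow> dist (g y) (g x0) < c / 8"
      using g(1) c x0' unfolding continuous_on_iff
      by (metis ComplI divide_pos_pos zero_less_numeral)
    show ?thesis
    proof (rule that[of "min d1 d2 / 2"])
      show "g x0 - c / 8 < g y" if "y \<notin> \<Omega>" "dist y x0 < 2 * (min d1 d2 / 2)" for y
      proof -
        have "\<bar>g y - g x0\<bar> < c / 8"
          using d2(2)[of y] that by (simp add: dist_real_def)
        then show ?thesis by linarith
      qed
    qed (use d1 d2 in auto)
  qed
  \<comment> \<open>Half the kernel mass of the two-sided tail from \<open>t\<close>. It blows up as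
    \<open>t\<close> tends to 0, so a small \<open>L\<close> outweighs both \<open>C\<close> and the
    loss beyond \<open>r\<close>.\<close>
  define J where "J t = t powr (1 - (1 + 2 * s)) / ((1 + 2 * s) - 1)" for t
  obtain L where L: "0 < L" "L < r" "J L \<ge> (C + (3 * c / 4 + 2 * (2 * M)) * J r) / (3 * c / 4)"
  proof -
    define A where "A = (C + (3 * c / 4 + 2 * (2 * M)) * J r) / (3 * c / 4)"
    \<comment> \<open>\<open>B powr (- 1 / (2 * s))\<close> is the length at which \<open>J\<close>
      equals \<open>max A 1\<close>; the maximum with 1 keeps \<open>B\<close> positive.\<close>
    define B where "B = 2 * s * max A 1"
    have B: "B > 0" using s by (simp add: B_def)
    define L where "L = min (r / 2) (B powr (- 1 / (2 * s)))"
    have L: "0 < L" "L < r" using r(1) B by (auto simp: L_def min_def)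
    have "B = (B powr (- 1 / (2 * s))) powr (- 2 * s)"
      using B s by (simp add: powr_powr)
    also have "\<dots> \<le> L powr (- 2 * s)"
      using L s by (intro powr_mono2') (auto simp: L_def)
    finally have "max A 1 \<le> J L"
      using s by (simp add: J_def B_def pos_le_divide_eq mult.commute del: max.bounded_iff)
    then show ?thesis
      using L that unfolding A_def by simp
  qed
  then have L_C: "C \<le> 3 * c / 4 * J L - (3 * c / 4 + 2 * (2 * M)) * J r"
    using c by (simp add: field_simps)
  \<comment> \<open>By compactness, points of the closure away from \<open>x0\<close> lie at depth
    at least \<eta> below the supporting hyperplane.\<close>
  obtain \<eta> where \<eta>: "\<eta> > 0" "\<And>y. y \<in> closure \<Omega> \<Longrightarrow> L / 2 \<le> dist y x0 \<Longrightarrow> n \<bullet> (y - x0) \<le> - \<eta>"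
  proof -
    let ?A = "closure \<Omega> - ball x0 (L / 2)"
    have A: "compact ?A"
      using \<Omega>(2) by (intro compact_diff) (auto simp: compact_closure)
    show ?thesis
    proof (cases "?A = {}")
      case True
      then show ?thesis by (intro that[of 1]) (auto simp: dist_commute)
    next
      case False
      have "continuous_on ?A (\<lambda>y. n \<bullet> (y - x0))"
        by (intro continuous_intros)
      from continuous_attains_sup[OF A False this] obtain y0
        where y0: "y0 \<in> ?A" "\<And>y. y \<in> ?A \<Longrightarrow> n \<bullet> (y - x0) \<le> n \<bullet> (y0 - x0)" by blast
      show ?thesis
      proof (rule that[of "- (n \<bullet> (y0 - x0))"])
        show "- (n \<bullet> (y0 - x0)) > 0"
          using n(2)[of y0] y0(1) L(1) by (cases "y0 = x0") auto
        show "n \<bullet> (y - x0) \<le> - (- (n \<bullet> (y0 - x0)))" if "y \<in> closure \<Omega>" "L / 2 \<le> dist y x0" for y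
          using y0(2)[of y] that by (auto simp: dist_commute)
      qed
    qed
  qed
  \<comment> \<open>A descent by \<eta> then costs more than the total oscillation
    \<open>2 * M\<close> of \<open>v\<close>; the added 1 makes this strict.\<close>
  define k where "k = (2 * M + 1) / \<eta>"
  have "M \<ge> 0" using M(1)[of x0] by linarith
  then have k: "k > 0" "k * \<eta> > 2 * M"
    using \<eta>(1) by (auto simp: k_def)
  have "lsc (\<lambda>y. v y + - k * (n \<bullet> (y - x0)))"
    by (intro lsc_add_continuous v continuous_intros)
  moreover have "compact (closure \<Omega>)" "closure \<Omega> \<noteq> {}"
    using \<Omega> by (auto simp: compact_closure)
  ultimately obtain x where x: "x \<in> closure \<Omega>"
    and x_min: "\<And>y. y \<in> closure \<Omega> \<Longrightarrow> v x + - k * (n \<bullet> (x - x0)) \<le> v y + - k * (n \<bullet> (y - x0))"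
    using lsc_attains_inf by blast
  \<comment> \<open>The depth of the minimiser below the hyperplane. Comparison with the competitor
    \<open>x0\<close> yields both \<open>d < \<eta>\<close>, hence closeness to \<open>x0\<close>,
    and \<open>v x \<le> v x0\<close>.\<close>
  define d where "d = - (n \<bullet> (x - x0))"
  have d: "d \<ge> 0"
    using n(2)[OF x] by (cases "x = x0") (auto simp: d_def)
  have kd: "v x + k * d \<le> v x0"
    using x_min[OF x0'(1)] by (simp add: d_def)
  have "k * d < k * \<eta>"
    using kd M(1)[of x] M(1)[of x0] k(2) by linarith
  then have "d < \<eta>" using k(1) by simp
  then have x_close: "dist x x0 < L / 2"
    using \<eta>(2)[OF x] by (force simp: d_def)
  have "k * d \<ge> 0" using k d by simp
  then have vx: "v x \<le> v x0" using kd by linarith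
  \<comment> \<open>Within distance \<open>c / (4 * k)\<close> the linear function of slope
    \<open>k\<close> rises by at most \<open>c / 4\<close>, less than the exterior jump
    \<open>7 * c / 8\<close>.\<close>
  define \<delta> where "\<delta> = min L (c / (4 * k))"
  have \<delta>: "0 < \<delta>" "\<delta> \<le> L" "k * \<delta> \<le> c / 4"
    using L(1) c k(1) by (auto simp: \<delta>_def min_def field_simps)
  have v_inside: "v x + k * (n \<bullet> (y - x)) \<le> v y" if "y \<in> closure \<Omega>" for y
    using x_min[OF that] by (simp add: inner_diff_right algebra_simps)
  have near_x0: "dist y x0 < 2 * r" if "dist y x < r" for y
    using that x_close L dist_triangle[of y x0 x] by linarith
  have v_near: "v x - c / 8 \<le> v y" if "dist y x < r" for y
    using r(2)[OF near_x0[OF that]] vx by linarith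
  have g_near: "v x + 7 * c / 8 \<le> g y" if "y \<notin> \<Omega>" "dist y x < r" for y
    using r(3)[OF that(1) near_x0[OF that(2)]] vx unfolding c_def by argo
  have touch: "v x - (k *\<^sub>R n) \<bullet> x \<le> v y - (k *\<^sub>R n) \<bullet> y" if "y \<in> ball x \<delta>" for y
  proof (cases "y \<in> closure \<Omega>")
    case True
    then show ?thesis using v_inside[of y] by (simp add: inner_diff_right algebra_simps)
  next
    case False
    then have "y \<notin> \<Omega>" using closure_subset by blast
    have "dist y x < \<delta>" using that by (simp add: dist_commute)
    then have "v x + 7 * c / 8 \<le> v y"
      using g_near[OF \<open>y \<notin> \<Omega>\<close>] ext[OF False] \<delta>(2) L(2) by linarith
    moreover have "n \<bullet> (y - x) \<le> \<delta>"
      using norm_cauchy_schwarz[of n "y - x"] n(1) \<open>dist y x < \<delta>\<close> by (simp add: dist_norm)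
    then have "k * (n \<bullet> (y - x)) \<le> c / 4"
      using mult_left_mono[of "n \<bullet> (y - x)" \<delta> k] k(1) \<delta>(3) by linarith
    ultimately show ?thesis
      using c by (simp add: inner_diff_right algebra_simps)
  qed
  have tail: "C \<le> integral {t. \<delta> \<le> \<bar>t\<bar>}
      (\<lambda>t. (lower_ext \<Omega> g v (x + t *\<^sub>R z) - v x) / \<bar>t\<bar> powr (1 + 2 * s))" if z: "norm z = 1" for z
  proof -
    define F where "F t = lower_ext \<Omega> g v (x + t *\<^sub>R z) - v x" for t
    note [measurable] = lower_ext_measurable[OF \<Omega>(1) v(1) g(1)]
    have [measurable]: "F \<in> borel_measurable borel"
      unfolding F_def by measurable
    have F_bound: "\<bar>F t\<bar> \<le> 2 * M" for t
      using w_bound[of "x + t *\<^sub>R z"] M(1)[of x] unfolding F_def by linarith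
    have dist_line: "dist (x + t *\<^sub>R z) x = \<bar>t\<bar>" for t
      using z by (simp add: dist_norm)
    have F_out: "7 * c / 8 \<le> F t" if "\<bar>t\<bar> < r" "x + t *\<^sub>R z \<notin> closure \<Omega>" for t
      using g_near[of "x + t *\<^sub>R z"] that dist_line[of t] closure_subset[of \<Omega>]
      by (auto simp: F_def lower_ext_def frontier)
    \<comment> \<open>On the frontier the extension is a minimum: if \<open>g\<close> is selected
      the first alternative holds, if \<open>v\<close> is selected the second.\<close>
    have F_cases: "7 * c / 8 \<le> F t \<or> (- c / 8 \<le> F t \<and> t * (k * (n \<bullet> z)) \<le> F t)" if "\<bar>t\<bar> < r" for t
    proof (cases "x + t *\<^sub>R z \<in> closure \<Omega>")
      case True
      then show ?thesis
        using v_inside[OF True] v_near[of "x + t *\<^sub>R z"] g_near[of "x + t *\<^sub>R z"] that dist_line[of t]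
        by (auto simp: F_def lower_ext_def frontier min_def algebra_simps)
    qed (use F_out that in auto)
    \<comment> \<open>The sign condition makes the point at parameter \<open>t\<close> no deeper
      than \<open>x\<close>, so its depth is below \<eta>, while its distance from \<open>x0\<close>
      is at least \<open>L - L / 2\<close>. By the choice of \<eta> it is exterior, and
      \<open>7 * c / 8 - c / 8\<close> remains.\<close>
    have F_far: "3 * c / 4 \<le> F t + F (- t)" if t: "L \<le> \<bar>t\<bar>" "\<bar>t\<bar> < r" "0 \<le> t * (n \<bullet> z)" for t
    proof -
      have "dist (x + t *\<^sub>R z) x0 \<ge> L / 2"
        using dist_triangle[of "x + t *\<^sub>R z" x x0] dist_line[of t] t(1) x_close
        by (simp add: dist_commute)
      moreover have "n \<bullet> (x + t *\<^sub>R z - x0) > - \<eta>"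
        using t(3) \<open>d < \<eta>\<close> by (simp add: d_def inner_simps)
      ultimately have "x + t *\<^sub>R z \<notin> closure \<Omega>"
        using \<eta>(2) by force
      then show ?thesis
        using F_out[of t] F_cases[of "- t"] t c by auto
    qed
    have "3 * c / 4 * J L - (3 * c / 4 + 2 * (2 * M)) * J r
        \<le> integral {t. \<delta> \<le> \<bar>t\<bar>} (\<lambda>t. F t / \<bar>t\<bar> powr (1 + 2 * s))"
      unfolding J_def
    proof (rule integral_powr_tail_lower)
      show "0 \<le> F t + F (- t)" if "\<delta> \<le> \<bar>t\<bar>" "\<bar>t\<bar> < r" for t
        using F_cases[of t] F_cases[of "- t"] that c by auto
      \<comment> \<open>One of \<open>t\<close> and \<open>- t\<close> satisfies the sign condition,
        and the sum is symmetric in them.\<close>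
      show "3 * c / 4 \<le> F t + F (- t)" if "L \<le> \<bar>t\<bar>" "\<bar>t\<bar> < r" for t
        using F_far[of t] F_far[of "- t"] that by (cases "0 \<le> t * (n \<bullet> z)") auto
    qed (use \<delta> L s c F_bound in auto)
    then show ?thesis
      using L_C unfolding F_def by linarith
  qed
  show thesis
  proof (rule that[where a = "k *\<^sub>R n", OF \<delta>(1) x])
    show "x \<in> frontier \<Omega> \<longrightarrow> v x < g x"
      using g_near[of x] frontier r(1) c by auto
  qed (use touch tail in auto)
qed

section \<open>Boundary inequalities for super- and subsolutions\<close>

lemma upper_ext_conv_lower_ext:
  "upper_ext \<Omega> g u x = - lower_ext \<Omega> (\<lambda>x. - g x) (\<lambda>x. - u x) x"
  by (auto simp: upper_ext_def lower_ext_def)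

lemma supersolution_core_ge_boundary:
  fixes \<Omega> :: "'a::euclidean_space set" and f g v :: "'a \<Rightarrow> real"
  assumes s: "s > 0"
    and \<Omega>: "open \<Omega>" "bounded \<Omega>" "\<Omega> \<noteq> {}" "strictly_convex_set \<Omega>"
    and f: "bounded (f ` closure \<Omega>)"
    and g: "continuous_on (- \<Omega>) g" "bounded (g ` (- \<Omega>))"
    and v: "lsc v" "bounded (range v)" "visc_super_core s \<Omega> f g v"
    and x0: "x0 \<in> frontier \<Omega>"
  shows "g x0 \<le> v x0"
proof (rule ccontr)
  assume "\<not> g x0 \<le> v x0"
  then have less: "v x0 < g x0" by simp
  have ext: "\<And>x. x \<notin> closure \<Omega> \<Longrightarrow> g x \<le> v x"
    using v(3) by (auto simp: visc_super_core_def)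
  obtain B where B: "\<And>x. x \<in> closure \<Omega> \<Longrightarrow> \<bar>f x\<bar> \<le> B"
    using f unfolding bounded_iff by auto
  \<comment> \<open>With \<open>C = B + 1\<close> a margin of 1 survives the subtraction of
    \<open>f x\<close>. Being uniform in the direction, it also survives the infimum and keeps it
    strictly positive.\<close>
  obtain a \<delta> x where *: "\<delta> > 0" "x \<in> closure \<Omega>"
    "\<forall>y\<in>ball x \<delta>. v x - a \<bullet> x \<le> v y - a \<bullet> y" "x \<in> frontier \<Omega> \<longrightarrow> v x < g x"
    "\<forall>z\<in>sphere 0 1. B + 1 \<le> integral {t. \<delta> \<le> \<bar>t\<bar>}
        (\<lambda>t. (lower_ext \<Omega> g v (x + t *\<^sub>R z) - v x) / \<bar>t\<bar> powr (1 + 2 * s))"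
    by (rule boundary_barrier[OF s \<Omega> v(1,2) g ext x0 less, of "B + 1"])
  have "1 \<le> Ezd s f z \<delta> v (lower_ext \<Omega> g v) (\<lambda>y. a \<bullet> y) x" if "z \<in> sphere 0 1" for z
    using bspec[OF *(5) that] B[OF *(2)] unfolding Ezd_inner by simp
  then have "1 \<le> (INF z\<in>sphere 0 1. Ezd s f z \<delta> v (lower_ext \<Omega> g v) (\<lambda>y. a \<bullet> y) x)"
    by (intro cINF_greatest) auto
  then have "Ed s f \<delta> v (lower_ext \<Omega> g v) (\<lambda>y. a \<bullet> y) x < 0"
    by (simp add: Ed_def)
  moreover have "x \<in> \<Omega> \<longrightarrow> Ed s f \<delta> v (lower_ext \<Omega> g v) (\<lambda>y. a \<bullet> y) x \<ge> 0"
    and "x \<in> frontier \<Omega> \<longrightarrow> max (Ed s f \<delta> v (lower_ext \<Omega> g v) (\<lambda>y. a \<bullet> y) x) (v x - g x) \<ge> 0"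
    using v(3) *(1,3) C2_on_inner[of UNIV a] unfolding visc_super_core_def by blast+
  moreover have "x \<in> \<Omega> \<or> x \<in> frontier \<Omega>"
    using *(2) \<Omega>(1) by (auto simp: frontier_def interior_open)
  ultimately show False using *(4) by auto
qed

text \<open>No equation is claimed for \<open>- u\<close>; only the barrier is used. Since the
  infimum must now be shown negative, one direction suffices, provided the infimum is bounded
  below.\<close>

lemma subsolution_core_le_boundary:
  fixes \<Omega> :: "'a::euclidean_space set" and f g u :: "'a \<Rightarrow> real"
  assumes s: "s > 0"
    and \<Omega>: "open \<Omega>" "bounded \<Omega>" "\<Omega> \<noteq> {}" "strictly_convex_set \<Omega>"
    and f: "bounded (f ` closure \<Omega>)"
    and g: "continuous_on (- \<Omega>) g" "bounded (g ` (- \<Omega>))"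
    and u: "usc u" "bounded (range u)" "visc_sub_core s \<Omega> f g u"
    and x0: "x0 \<in> frontier \<Omega>"
  shows "u x0 \<le> g x0"
proof (rule ccontr)
  assume "\<not> u x0 \<le> g x0"
  then have less: "- u x0 < - g x0" by simp
  define w where "w = lower_ext \<Omega> (\<lambda>x. - g x) (\<lambda>x. - u x)"
  have upper: "upper_ext \<Omega> g u = (\<lambda>x. - w x)"
    by (simp add: w_def upper_ext_conv_lower_ext fun_eq_iff)
  have ext: "\<And>x. x \<notin> closure \<Omega> \<Longrightarrow> - g x \<le> - u x"
    using u(3) by (auto simp: visc_sub_core_def)
  have u': "lsc (\<lambda>x. - u x)" "bounded (range (\<lambda>x. - u x))"
    using u by (auto simp: lsc_uminus_iff bounded_iff)
  have g': "continuous_on (- \<Omega>) (\<lambda>x. - g x)" "bounded ((\<lambda>x. - g x) ` (- \<Omega>))"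
    using g by (auto simp: bounded_iff intro: continuous_intros)
  obtain B where B: "\<And>x. x \<in> closure \<Omega> \<Longrightarrow> \<bar>f x\<bar> \<le> B"
    using f unfolding bounded_iff by auto
  obtain M1 M2 where "\<And>x. \<bar>u x\<bar> \<le> M1" "\<And>x. x \<notin> \<Omega> \<Longrightarrow> \<bar>g x\<bar> \<le> M2"
    using u(2) g(2) unfolding bounded_iff by auto
  then obtain M where M: "\<And>x. \<bar>u x\<bar> \<le> M" "\<And>x. x \<notin> \<Omega> \<Longrightarrow> \<bar>g x\<bar> \<le> M"
    by (metis max.coboundedI1 max.coboundedI2)
  have w_bound: "\<bar>w x\<bar> \<le> M" for x
    using M[of x] by (auto simp: w_def lower_ext_def)
  note [measurable] = lower_ext_measurable[OF \<Omega>(1) u'(1) g'(1), folded w_def]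
  define T where "T \<delta> x z = integral {t. \<delta> \<le> \<bar>t\<bar>}
      (\<lambda>t. (w (x + t *\<^sub>R z) - - u x) / \<bar>t\<bar> powr (1 + 2 * s))" for \<delta> x z
  obtain a \<delta> x where *: "\<delta> > 0" "x \<in> closure \<Omega>"
    "\<forall>y\<in>ball x \<delta>. - u x - a \<bullet> x \<le> - u y - a \<bullet> y" "x \<in> frontier \<Omega> \<longrightarrow> - u x < - g x"
    "\<forall>z\<in>sphere 0 1. B + 1 \<le> T \<delta> x z"
    by (rule boundary_barrier[OF s \<Omega> u' g' ext x0 less, of "B + 1", folded w_def, folded T_def])
  let ?E = "\<lambda>z. Ezd s f z \<delta> u (upper_ext \<Omega> g u) (\<lambda>y. (- a) \<bullet> y) x"
  have E: "?E z = - T \<delta> x z - f x" for z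
    unfolding Ezd_inner upper T_def integral_neg[symmetric]
    by (simp add: minus_divide_left)
  have "T \<delta> x z \<le> 2 * M * (2 * (\<delta> powr (1 - (1 + 2 * s)) / ((1 + 2 * s) - 1)))" for z
    unfolding T_def
  proof (rule integral_powr_tail_bound)
    show "\<bar>w (x + t *\<^sub>R z) - - u x\<bar> \<le> 2 * M" for t
      using w_bound[of "x + t *\<^sub>R z"] M(1)[of x] by linarith
  qed (use * s in auto)
  then have "bdd_below (?E ` sphere 0 1)"
    by (intro bdd_belowI[of _ "- (2 * M * (2 * (\<delta> powr (1 - (1 + 2 * s)) / ((1 + 2 * s) - 1)))) - f x"])
      (auto simp: E simp del: inner_minus_left)
  moreover obtain z :: 'a where z: "z \<in> sphere 0 1"
    using vector_choose_size[of 1] by auto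
  ultimately have "(INF z\<in>sphere 0 1. ?E z) \<le> ?E z"
    by (intro cINF_lower) auto
  also have "\<dots> \<le> -1"
    using bspec[OF *(5) z] B[OF *(2)] unfolding E by linarith
  finally have "Ed s f \<delta> u (upper_ext \<Omega> g u) (\<lambda>y. (- a) \<bullet> y) x > 0"
    by (simp add: Ed_def)
  moreover have "\<forall>y\<in>ball x \<delta>. u y - (- a) \<bullet> y \<le> u x - (- a) \<bullet> x"
    using *(3) by (auto simp: algebra_simps)
  then have "x \<in> \<Omega> \<longrightarrow> Ed s f \<delta> u (upper_ext \<Omega> g u) (\<lambda>y. (- a) \<bullet> y) x \<le> 0"
    and "x \<in> frontier \<Omega> \<longrightarrow> min (Ed s f \<delta> u (upper_ext \<Omega> g u) (\<lambda>y. (- a) \<bullet> y) x) (u x - g x) \<le> 0"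
    using u(3) *(1) C2_on_inner[of UNIV "- a"] unfolding visc_sub_core_def by blast+
  moreover have "x \<in> \<Omega> \<or> x \<in> frontier \<Omega>"
    using *(2) \<Omega>(1) by (auto simp: frontier_def interior_open)
  ultimately show False using *(4) by auto
qed

theorem theorem2p1:
  fixes s :: real and \<Omega> :: "'a::euclidean_space set"
    and f g u v :: "'a \<Rightarrow> real"
  assumes "0 < s" "s < 1"
    and "bdd_strictly_convex_C2_domain \<Omega>"
    and "continuous_on (closure \<Omega>) f" "bounded (f ` closure \<Omega>)"
    and "continuous_on (closure (- \<Omega>)) g" "bounded (g ` closure (- \<Omega>))"
    and "viscosity_subsolution s \<Omega> f g u"
    and "viscosity_supersolution s \<Omega> f g v"
  shows "(\<forall>x\<in>frontier \<Omega>. u x \<le> g x) \<and> (\<forall>x\<in>frontier \<Omega>. g x \<le> v x)"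
proof (intro conjI ballI)
  have \<Omega>: "open \<Omega>" "bounded \<Omega>" "\<Omega> \<noteq> {}" "strictly_convex_set \<Omega>"
    using assms(3) by (auto simp: bdd_strictly_convex_C2_domain_def)
  then have "closure (- \<Omega>) = - \<Omega>"
    by (intro closure_closed) auto
  then have g: "continuous_on (- \<Omega>) g" "bounded (g ` (- \<Omega>))"
    using assms by simp_all
  fix x assume x: "x \<in> frontier \<Omega>"
  show "u x \<le> g x"
  proof -
    define u' where "u' = (if usc u then u else usc_env u)"
    have bdd: "bounded (range u)" and core: "visc_sub_core s \<Omega> f g u'"
      using assms(8) by (simp_all add: viscosity_subsolution_def u'_def)
    \<comment> \<open>The envelope lies above \<open>u\<close>, so bounding it by \<open>g\<close>
      bounds \<open>u\<close>; the lower envelope of \<open>v\<close> works in the opposite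
      direction.\<close>
    have "usc u'" "bounded (range u')" "u x \<le> u' x"
      using bdd usc_usc_env bounded_usc_env usc_env_ge by (auto simp: u'_def)
    then show ?thesis
      using subsolution_core_le_boundary[OF assms(1) \<Omega> assms(5) g _ _ core x] by linarith
  qed
  show "g x \<le> v x"
  proof -
    define v' where "v' = (if lsc v then v else lsc_env v)"
    have bdd: "bounded (range v)" and core: "visc_super_core s \<Omega> f g v'"
      using assms(9) by (simp_all add: viscosity_supersolution_def v'_def)
    have neg: "bounded (range (\<lambda>x. - v x))"
      using bdd by (auto simp: bounded_iff)
    have env: "lsc_env v = (\<lambda>x. - usc_env (\<lambda>x. - v x) x)"
      by (simp add: lsc_env_conv_usc_env fun_eq_iff)
    have "lsc v'"
      using usc_usc_env[OF neg] by (simp add: v'_def env lsc_uminus_iff)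
    moreover have "bounded (range v')"
      using bdd bounded_usc_env[OF neg] by (auto simp: v'_def env bounded_iff)
    moreover have "v' x \<le> v x"
      using usc_env_ge[OF neg, of x] by (simp add: v'_def env)
    ultimately show ?thesis
      using supersolution_core_ge_boundary[OF assms(1) \<Omega> assms(5) g _ _ core x] by linarith
  qed
qed

end
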